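(* Let $L, P \in 2\mathbb{N}$ be fixed. Let $f \in W(C(\mathbb{R}),\ell^1(\mathbb{Z}))$ with $\hat f \in W(C(\mathbb{R}),\ell^1(\mathbb{Z}))$ be given. Then $\hat f$ can be uniformly approximated on $[-P/2,\,P/2]$ by the trigonometric sampling polynomial $s_{P,L}$, with the estimate $$M_{P,L}^{\ast}(f) \le M_{P,L}(f) \le \frac{1}{\sqrt L}\,\delta(\hat f,P) + \sqrt L\,\delta(f,L).$$
   Context: $2\mathbb{N}$ denotes the set of positive even integers. The Wiener amalgam space $W(C(\mathbb{R}),\ell^1(\mathbb{Z}))$ is the set of continuous $f:\mathbb{R}\to\mathbb{C}$ with $\|f\|_{W(C(\mathbb{R}),\ell^1(\mathbb{Z}))} := \sum_{k\in\mathbb{Z}} \max_{x\in[0,1]} |f(x+k)| < \infty$; such functions lie in $L^1(\mathbb{R})$. The Fourier transform is $\hat f(v) = \int_{\mathbb{R}} f(x)\,\mathrm{e}^{-2\pi \mathrm{i} xv}\,\mathrm{d}x$, $v\in\mathbb{R}$. For $L,P\in 2\mathbb{N}$ let $[LP] := \{ j\in\mathbb{Z} : -\tfrac{LP}{2} < j \le \tfrac{LP}{2}\}$ and define the $P$-periodic trigonometric sampling polynomial $$s_{P,L}(v) := \frac1P \sum_{n\in[LP]} f\!\left(\frac nP\right)\mathrm{e}^{-2\pi\mathrm{i} nv/P},\quad v\in\mathbb{R}.$$ The scaled maximum approximation errors are $$M_{P,L}(f) := \frac{1}{\sqrt L}\max_{|v|\le P/2}|\hat f(v)-s_{P,L}(v)|,\qquad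 M^{\ast}_{P,L}(f) := \frac{1}{\sqrt L}\max_{k\in[LP]}\left|\hat f\!\left(\tfrac kL\right)-s_{P,L}\!\left(\tfrac kL\right)\right|.$$ For $g\in W(C(\mathbb{R}),\ell^1(\mathbb{Z}))$ and $R\in 2\mathbb{N}$, the decay rate of $g$ with respect to step size $R$ is $$\delta(g,R) := \max_{|x|\le R/2}\sum_{k\in\mathbb{Z}\setminus\{0\}}|g(x+kR)|.$$ *)

theory Defs
  imports "HOL-Analysis.Analysis"
begin

text \<open>
  The informal definitions below take maxima of continuous functions over nonempty compact
  intervals. These are rendered as real suprema, which are attained for the functions in question.
  (For \<open>decay_rate\<close> of a function in the Wiener amalgam space, continuity of the inner sum follows
  from its locally uniform convergence.)
\<close>

text \<open>
  The terms are nonnegative, so \<open>summable_on\<close> says exactly that the norm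
  \<open>\<Sum>\<^sub>k max\<^bsub>x \<in> [0,1]\<^esub> |f (x + k)|\<close> is finite.
\<close>
definition wiener_amalgam :: "(real \<Rightarrow> complex) set" where
  "wiener_amalgam =
     {f. continuous_on UNIV f \<and>
         (\<lambda>k::int. SUP x\<in>{0..1}. cmod (f (x + of_int k))) summable_on UNIV}"

definition fourier :: "(real \<Rightarrow> complex) \<Rightarrow> real \<Rightarrow> complex" where
  "fourier f v = (LINT x|lborel. f x * exp (- 2 * complex_of_real pi * \<i> * of_real x * of_real v))"

definition index_range :: "nat \<Rightarrow> int set" where
  "index_range N = {j. - (real N / 2) < of_int j \<and> of_int j \<le> real N / 2}"

definition sampling_poly :: "(real \<Rightarrow> complex) \<Rightarrow> nat \<Rightarrow> nat \<Rightarrow> real \<Rightarrow> complex" where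
  "sampling_poly f P L v =
     1 / of_nat P *
       (\<Sum>n\<in>index_range (L * P). f (of_int n / real P) *
          exp (- 2 * complex_of_real pi * \<i> * of_int n * of_real v / of_nat P))"

definition max_error :: "(real \<Rightarrow> complex) \<Rightarrow> nat \<Rightarrow> nat \<Rightarrow> real" where
  "max_error f P L =
     1 / sqrt (real L) *
       (SUP v\<in>{v. \<bar>v\<bar> \<le> real P / 2}. cmod (fourier f v - sampling_poly f P L v))"

definition discrete_max_error :: "(real \<Rightarrow> complex) \<Rightarrow> nat \<Rightarrow> nat \<Rightarrow> real" where
  "discrete_max_error f P L =
     1 / sqrt (real L) *
       Max ((\<lambda>k. cmod (fourier f (of_int k / real L) - sampling_poly f P L (of_int k / real L)))
              ` index_range (L * P))"

definition decay_rate :: "(real \<Rightarrow> complex) \<Rightarrow> nat \<Rightarrow> real" where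
  "decay_rate g R =
     (SUP x\<in>{x. \<bar>x\<bar> \<le> real R / 2}. \<Sum>\<^sub>\<infinity>k\<in>UNIV - {0::int}. cmod (g (x + of_int k * real R)))"

end

theory Submission
  imports Defs
begin

text \<open>
  Poisson summation for \<open>x \<mapsto> f (x / P) cis (- 2 \<pi> v x / P)\<close>
  identifies the full sampling series, summed over all integers, with the \<open>P\<close>-periodization of
  the Fourier transform of \<open>f\<close>. Truncating the series to \<open>[LP]\<close> costs the samples outside
  \<open>[LP]\<close>, which are grouped modulo \<open>LP\<close> into \<open>LP\<close> sums each bounded by the decay rate of \<open>f\<close>;
  the aliases \<open>k \<noteq> 0\<close> of the periodization are bounded by the decay rate of the transform.
  Poisson summation itself rests on the fact that a continuous periodic function
  with vanishing Fourier coefficients is zero, a consequence of Stone--Weierstrass on the circle.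
\<close>

section \<open>Uniqueness of Fourier coefficients\<close>

lemma periodic_shift_int:
  fixes h :: "real \<Rightarrow> 'a"
  assumes per: "\<And>x. h (x + 1) = h x"
  shows "h (x + of_int k) = h x"
proof (induction k rule: int_induct[where k = 0])
  case (step1 i)
  then show ?case using per[of "x + of_int i"] by (simp add: add.assoc)
next
  case (step2 i)
  then show ?case using per[of "x + of_int (i - 1)"] by (simp add: algebra_simps)
qed simp

text \<open>Stone-Weierstrass needs a compact domain on which 1-periodicity is built in; the circle
  is that domain, being the quotient of \<open>{0..1}\<close> that glues its endpoints.\<close>

lemma periodic_factors_through_circle:
  fixes h :: "real \<Rightarrow> complex"
  assumes cont: "continuous_on {0..1} h" and per: "\<And>x. h (x + 1) = h x"
  obtains g where "continuous_on (sphere 0 1) g" "\<And>x. g (cis (2 * pi * x)) = h x"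
proof -
  define g where "g z = h (Arg2pi z / (2 * pi))" for z
  have g: "g (cis (2 * pi * x)) = h x" for x
  proof -
    have "Arg2pi (cis (2 * pi * x)) = 2 * pi * frac x"
    proof (rule Arg2pi_unique[of 1])
      have "cis (2 * pi * x) = cis (2 * pi * frac x + 2 * pi * of_int \<lfloor>x\<rfloor>)"
        by (simp add: frac_def algebra_simps)
      also have "\<dots> = cis (2 * pi * frac x)"
        by (simp only: cis_mult[symmetric] cis_multiple_2pi[OF Ints_of_int]) simp
      finally show "of_real 1 * exp (\<i> * of_real (2 * pi * frac x)) = cis (2 * pi * x)"
        by (simp add: cis_conv_exp)
    qed (auto simp: frac_lt_1)
    then have "g (cis (2 * pi * x)) = h (frac x)" by (simp add: g_def)
    also have "\<dots> = h x"
      using periodic_shift_int[of h, OF per, of "frac x" "\<lfloor>x\<rfloor>"] by (simp add: frac_def)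
    finally show ?thesis .
  qed
  \<comment> \<open>\<open>Arg2pi\<close> jumps at 1, so continuity of \<open>g\<close> cannot be
    read off its definition. Instead, each preimage of a closed set is the image of a compact subset
    of \<open>{0..1}\<close> under the continuous parametrization, hence closed.\<close>
  have "closed (g -` B \<inter> sphere 0 1)" if "closed B" for B
  proof -
    have "g -` B \<inter> sphere 0 1 = (\<lambda>x. cis (2 * pi * x)) ` ({0..1} \<inter> h -` B)"
    proof (intro equalityI subsetI)
      fix z assume z: "z \<in> g -` B \<inter> sphere 0 1"
      define x where "x = Arg2pi z / (2 * pi)"
      have "z = cis (2 * pi * x)"
        using z Arg2pi_eq[of z] by (simp add: x_def cis_conv_exp)
      moreover have "x \<in> {0..1}"
        using Arg2pi_ge_0[of z] Arg2pi_lt_2pi[of z] by (simp add: x_def)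
      ultimately show "z \<in> (\<lambda>x. cis (2 * pi * x)) ` ({0..1} \<inter> h -` B)"
        using z g by auto
    qed (auto simp: g)
    moreover have "compact ({0..1} \<inter> h -` B)"
      using continuous_closed_preimage[OF cont closed_atLeastAtMost that]
      by (simp add: compact_eq_bounded_closed bounded_Int Int_commute)
    then have "compact ((\<lambda>x. cis (2 * pi * x)) ` ({0..1} \<inter> h -` B))"
      by (intro compact_continuous_image continuous_intros)
    ultimately show ?thesis using compact_imp_closed by metis
  qed
  then have "continuous_on (sphere 0 1) g"
    by (simp add: continuous_on_closed_vimage)
  with g that show thesis by blast
qed

section \<open>Trigonometric polynomials and their uniform density\<close>

inductive trig_poly :: "(real \<Rightarrow> complex) \<Rightarrow> bool" where
  monom: "trig_poly (\<lambda>x. c * cis (2 * pi * of_int k * x))"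
| add: "trig_poly p \<Longrightarrow> trig_poly q \<Longrightarrow> trig_poly (\<lambda>x. p x + q x)"

lemma trig_poly_const: "trig_poly (\<lambda>x. c)"
  using monom[of c 0] by simp

lemma trig_poly_mult:
  assumes "trig_poly p" "trig_poly q"
  shows "trig_poly (\<lambda>x. p x * q x)"
  using assms
proof (induction p rule: trig_poly.induct)
  case (monom c k)
  from monom show ?case
  proof (induction q rule: trig_poly.induct)
    case (monom d j)
    have "(\<lambda>x. c * cis (2 * pi * of_int k * x) * (d * cis (2 * pi * of_int j * x)))
        = (\<lambda>x. c * d * cis (2 * pi * of_int (k + j) * x))"
      by (simp add: fun_eq_iff distrib_left distrib_right cis_mult[symmetric])
    then show ?case using trig_poly.monom[of "c * d" "k + j"] by simp
  next
    case (add p q)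
    then show ?case by (simp only: distrib_left trig_poly.add)
  qed
next
  case (add p q)
  then show ?case by (simp only: distrib_right trig_poly.add)
qed

lemma trig_poly_continuous: "trig_poly p \<Longrightarrow> continuous_on S p"
  by (induction rule: trig_poly.induct) (auto intro!: continuous_intros)

text \<open>Euler's formulas turn a real-linear functional on the circle into a combination of
  \<open>cis t\<close> and \<open>cis (- t)\<close>; closure under sums and products does the
  rest.\<close>

lemma trig_poly_real_polynomial_on_circle:
  assumes "real_polynomial_function r"
  shows "trig_poly (\<lambda>x. of_real (r (cis (2 * pi * x))))"
  using assms
proof (induction rule: real_polynomial_function.induct)
  case (linear r)
  interpret bounded_linear r by fact
  have r: "r z = Re z * r 1 + Im z * r \<i>" for z
  proof -
    have "z = Re z *\<^sub>R 1 + Im z *\<^sub>R \<i>" by (simp add: complex_eq_iff)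
    then have "r z = r (Re z *\<^sub>R 1 + Im z *\<^sub>R \<i>)" by simp
    then show ?thesis by (simp only: add scaleR) simp
  qed
  \<comment> \<open>With \<open>a = r 1\<close> and \<open>b = r \<i>\<close>, this is a cos t + b
    sin t = (a - ib)/2 e^(it) + (a + ib)/2 e^(-it).\<close>
  have "of_real (r (cis (2 * pi * x)))
      = Complex (r 1 / 2) (- r \<i> / 2) * cis (2 * pi * of_int 1 * x)
      + Complex (r 1 / 2) (r \<i> / 2) * cis (2 * pi * of_int (-1) * x)" for x
    by (subst r) (simp add: complex_eq_iff)
  then show ?case
    using trig_poly.add[OF trig_poly.monom[of _ 1] trig_poly.monom[of _ "-1"]] by simp
qed (auto simp: trig_poly_const trig_poly.add trig_poly_mult)

lemma trig_poly_dense: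
  fixes h :: "real \<Rightarrow> complex"
  assumes "continuous_on {0..1} h" "\<And>x. h (x + 1) = h x" "0 < e"
  obtains q where "trig_poly q" "\<And>x. cmod (h x - q x) < e"
proof -
  obtain g where g: "continuous_on (sphere 0 1) g" "\<And>x. g (cis (2 * pi * x)) = h x"
    using periodic_factors_through_circle[of h] assms by metis
  obtain p where p: "polynomial_function p" "\<And>z. z \<in> sphere 0 1 \<Longrightarrow> cmod (g z - p z) < e"
    using Stone_Weierstrass_polynomial_function[OF _ g(1) assms(3)] by auto
  have "real_polynomial_function (\<lambda>z. Re (p z))" "real_polynomial_function (\<lambda>z. Im (p z))"
    using p(1) bounded_linear_Re bounded_linear_Im by (auto simp: polynomial_function_def o_def)
  then have "trig_poly (\<lambda>x. of_real (Re (p (cis (2 * pi * x))))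
      + \<i> * of_real (Im (p (cis (2 * pi * x)))))"
    by (intro trig_poly.add trig_poly_mult trig_poly_const trig_poly_real_polynomial_on_circle)
  then have "trig_poly (\<lambda>x. p (cis (2 * pi * x)))"
    by (simp only: complex_eq[symmetric])
  moreover have "cmod (h x - p (cis (2 * pi * x))) < e" for x
    using p(2)[of "cis (2 * pi * x)"] by (simp add: g(2))
  ultimately show thesis using that by blast
qed

text \<open>By linearity \<open>h\<close> is orthogonal to every trigonometric polynomial. These
  approximate \<open>cnj h\<close> uniformly, so the integral of the squared modulus of
  \<open>h\<close> vanishes, and continuity forces \<open>h\<close> to be zero.\<close>

lemma zero_of_fourier_coefficients_zero:
  fixes h :: "real \<Rightarrow> complex"
  assumes ch: "continuous_on {0..1} h" and per: "\<And>x. h (x + 1) = h x"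
    and coeff: "\<And>k::int. integral {0..1} (\<lambda>x. h x * cis (2 * pi * of_int k * x)) = 0"
  shows "h x = 0"
proof -
  have orth: "integral {0..1} (\<lambda>x. h x * q x) = 0" if "trig_poly q" for q
    using that
  proof (induction rule: trig_poly.induct)
    case (monom c k)
    have "integral {0..1} (\<lambda>x. c * (h x * cis (2 * pi * of_int k * x))) = 0"
      by (simp only: integral_mult_right coeff) simp
    then show ?case by (simp add: mult.left_commute)
  next
    case (add p q)
    then show ?case
      by (simp add: distrib_left integral_add integrable_continuous_interval
          continuous_on_mult ch trig_poly_continuous)
  qed
  obtain B where B: "\<And>x. x \<in> {0..1} \<Longrightarrow> cmod (h x) \<le> B"
    using compact_imp_bounded[OF compact_continuous_image[OF ch compact_Icc[of 0 1]]]
    unfolding bounded_iff by blast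
  have B0: "0 \<le> B" using order_trans[OF norm_ge_zero B[of 0]] by simp
  define I where "I = integral {0..1} (\<lambda>x. h x * cnj (h x))"
  \<comment> \<open>Subtracting \<open>q\<close> from \<open>cnj (h x)\<close> leaves the integral
    unchanged by orthogonality, but makes the second factor smaller than \<open>e\<close>.\<close>
  have I_le: "cmod I \<le> B * e" if e: "e > 0" for e
  proof -
    obtain q where q: "trig_poly q" "\<And>x. cmod (cnj (h x) - q x) < e"
      using trig_poly_dense[of "\<lambda>x. cnj (h x)" e, OF continuous_on_cnj[OF ch] _ e] per
      by metis
    have "I = integral {0..1} (\<lambda>x. h x * (cnj (h x) - q x))"
      by (simp add: I_def right_diff_distrib integral_diff orth q integrable_continuous_interval
          continuous_intros ch trig_poly_continuous)
    also have "cmod \<dots> \<le> B * e * (1 - 0)"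
    proof (rule integral_bound)
      fix x :: real assume "x \<in> {0..1}"
      then show "cmod (h x * (cnj (h x) - q x)) \<le> B * e"
        unfolding norm_mult using B q(2)[of x] B0 by (intro mult_mono) (auto intro: less_imp_le)
    qed (auto intro!: continuous_intros ch trig_poly_continuous[OF q(1)])
    finally show ?thesis by simp
  qed
  have I0: "cmod I \<le> e" if "e > 0" for e
  proof -
    \<comment> \<open>The denominator is \<open>B + 1\<close> because \<open>B\<close> may be
      0.\<close>
    have "cmod I \<le> B * (e / (B + 1))" using B0 that by (intro I_le) simp
    also have "\<dots> \<le> e" using B0 that by (simp add: field_simps)
    finally show ?thesis .
  qed
  then have "I = 0" by (metis field_le_epsilon add_0 norm_le_zero_iff)
  moreover have "I = of_real (integral {0..1} (\<lambda>x. (cmod (h x))\<^sup>2))"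
    unfolding I_def complex_norm_square[symmetric] of_real_power[symmetric]
    by (intro integral_unique has_integral_of_real integrable_integral
        integrable_continuous_interval continuous_intros ch)
  ultimately have "integral {0..1} (\<lambda>x. (cmod (h x))\<^sup>2) = 0" by simp
  then have "\<forall>x\<in>{0..1}. (cmod (h x))\<^sup>2 = 0"
    by (subst (asm) integral_eq_0_iff) (auto intro!: continuous_intros ch)
  then have "h (frac x) = 0" using frac_lt_1[of x] by simp
  then show ?thesis
    using periodic_shift_int[of h, OF per, of "frac x" "\<lfloor>x\<rfloor>"] by (simp add: frac_def)
qed

section \<open>Poisson summation\<close>

text \<open>The Weierstrass M-test gives uniform convergence along the finite index sets, and
  uniform limits preserve continuity and commute with the integral. This serves both the
  periodization and the Fourier series.\<close>

lemma integral_infsum_unit_interval: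
  fixes f :: "'i \<Rightarrow> real \<Rightarrow> complex"
  assumes cont: "\<And>k. continuous_on {0..1} (f k)"
    and bound: "\<And>k x. x \<in> {0..1} \<Longrightarrow> cmod (f k x) \<le> M k"
    and M: "M summable_on UNIV"
  shows "continuous_on {0..1} (\<lambda>x. \<Sum>\<^sub>\<infinity>k. f k x)"
    and "((\<lambda>k. integral {0..1} (f k)) has_sum integral {0..1} (\<lambda>x. \<Sum>\<^sub>\<infinity>k. f k x)) UNIV"
proof -
  have ul: "uniform_limit {0..1} (\<lambda>Y x. \<Sum>k\<in>Y. f k x) (\<lambda>x. \<Sum>\<^sub>\<infinity>k. f k x)
      (finite_subsets_at_top UNIV)"
    using bound M by (intro Weierstrass_m_test_general) auto
  have c: "continuous_on {0..1} (\<lambda>x. \<Sum>k\<in>Y. f k x)" for Y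
    by (intro continuous_intros cont)
  show "continuous_on {0..1} (\<lambda>x. \<Sum>\<^sub>\<infinity>k. f k x)"
    by (rule uniform_limit_theorem[OF _ ul]) (auto simp: c)
  obtain I J where I: "\<And>Y. ((\<lambda>x. \<Sum>k\<in>Y. f k x) has_integral I Y) {0..1}"
      and J: "((\<lambda>x. \<Sum>\<^sub>\<infinity>k. f k x) has_integral J) {0..1}"
      and lim: "(I \<longlongrightarrow> J) (finite_subsets_at_top UNIV)"
    using uniform_limit_integral[OF ul c] by auto
  \<comment> \<open>The limit theorem yields the integrals only as anonymous values
    \<open>I Y\<close>; they are identified on finite \<open>Y\<close>, which is all that the filter
    sees.\<close>
  have "\<forall>\<^sub>F Y in finite_subsets_at_top UNIV. I Y = (\<Sum>k\<in>Y. integral {0..1} (f k))"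
  proof (rule eventually_finite_subsets_at_top_weakI)
    fix Y :: "'i set" assume "finite Y"
    then show "I Y = (\<Sum>k\<in>Y. integral {0..1} (f k))"
      using integral_unique[OF I[of Y]]
      by (simp add: integral_sum integrable_continuous_interval cont)
  qed
  then show "((\<lambda>k. integral {0..1} (f k)) has_sum integral {0..1} (\<lambda>x. \<Sum>\<^sub>\<infinity>k. f k x)) UNIV"
    using lim integral_unique[OF J] unfolding has_sum_def
    by (simp add: tendsto_cong)
qed

section \<open>Integrals over the line as sums over unit cells\<close>

lemma integral_symmetric_interval_split:
  fixes f :: "real \<Rightarrow> 'a :: euclidean_space"
  assumes cont: "continuous_on UNIV f"
  shows "integral {- real N..real N} f
    = (\<Sum>m\<in>{- int N..<int N}. integral {0..1} (\<lambda>x. f (x + of_int m)))"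
proof (induction N)
  case (Suc N)
  have int: "f integrable_on {a..b}" for a b
    using cont continuous_on_subset by (intro integrable_continuous_interval) blast
  have cell: "integral {0..1} (\<lambda>x. f (x + of_int m)) = integral {of_int m..of_int m + 1} f" for m
    using integral_shift_real_ivl[of "of_int m" "of_int m" "of_int m + 1" f] by simp
  have "integral {- real (Suc N)..real (Suc N)} f
      = integral {- real (Suc N)..- real N} f + integral {- real N..real N} f
        + integral {real N..real (Suc N)} f"
    by (simp add: Henstock_Kurzweil_Integration.integral_combine[OF _ _ int])
  moreover have "{- int (Suc N)..<int (Suc N)} = insert (- int (Suc N)) (insert (int N) {- int N..<int N})"
    by auto
  ultimately show ?case
    using cell[of "- int (Suc N)"] cell[of "int N"] by (simp add: Suc add_ac)
qed simp

text \<open>Turns an unordered sum over the integers into the limit of its symmetric partial sums,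
  so that it can be compared with integrals over growing intervals.\<close>

lemma filterlim_symmetric_int_intervals:
  "filterlim (\<lambda>N. {- int N..<int N}) (finite_subsets_at_top UNIV) sequentially"
  unfolding filterlim_finite_subsets_at_top
proof (intro allI impI)
  fix X :: "int set" assume X: "finite X \<and> X \<subseteq> UNIV"
  \<comment> \<open>Inserting 0 covers empty \<open>X\<close>; the extra 1 is needed because the
    intervals are open on the right.\<close>
  define N where "N = nat (Max (insert 0 (abs ` X)) + 1)"
  have "X \<subseteq> {- int n..<int n}" if "n \<ge> N" for n
  proof
    fix x assume "x \<in> X"
    then have "\<bar>x\<bar> \<le> Max (insert 0 (abs ` X))" using X by (intro Max_ge) auto
    then show "x \<in> {- int n..<int n}" using that by (auto simp: N_def)
  qed
  then show "\<forall>\<^sub>F n in sequentially. finite {- int n..<int n} \<and> X \<subseteq> {- int n..<int n}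
      \<and> {- int n..<int n} \<subseteq> UNIV"
    by (auto simp: eventually_sequentially)
qed

text \<open>The truncations of the norm of \<open>u\<close> to \<open>[-N, N]\<close> increase to
  it, and their integrals, cut into unit cells, stay below the sum of \<open>B\<close>; monotone
  convergence concludes.\<close>

lemma integrable_of_cell_bound:
  fixes u :: "real \<Rightarrow> complex"
  assumes cont: "continuous_on UNIV u"
    and bound: "\<And>k x. x \<in> {0..1} \<Longrightarrow> cmod (u (x + of_int k)) \<le> B k"
    and B: "B summable_on (UNIV :: int set)"
  shows "integrable lborel u"
proof -
  have B0: "B k \<ge> 0" for k using order_trans[OF norm_ge_zero bound[of 0 k]] by simp
  have meas[measurable]: "u \<in> borel_measurable borel"
    using cont by (rule borel_measurable_continuous_onI)
  have cn: "continuous_on S (\<lambda>x. cmod (u x))" for S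
    using cont continuous_on_subset by (intro continuous_intros) blast
  define F where "F N x = indicator {- real N..real N} x *\<^sub>R cmod (u x)" for N x
  have set_int: "set_integrable lborel {- real N..real N} (\<lambda>x. cmod (u x))" for N
    by (intro borel_integrable_atLeastAtMost' cn)
  then have F_int: "integrable lborel (F N)" for N
    by (simp add: set_integrable_def F_def[abs_def])
  have F_mono: "F N x \<le> F N' x" if "N \<le> N'" for N N' x
    using that by (auto simp: F_def indicator_def)
  have bdd: "integral\<^sup>L lborel (F N) \<le> infsum B UNIV" for N
  proof -
    have "integral\<^sup>L lborel (F N) = integral {- real N..real N} (\<lambda>x. cmod (u x))"
      using set_borel_integral_eq_integral(2)[OF set_int]
      by (simp add: set_lebesgue_integral_def F_def[abs_def])
    also have "\<dots> = (\<Sum>m\<in>{- int N..<int N}. integral {0..1} (\<lambda>x. cmod (u (x + of_int m))))"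
      by (rule integral_symmetric_interval_split) (rule cn)
    also have "\<dots> \<le> (\<Sum>m\<in>{- int N..<int N}. B m)"
    proof (rule sum_mono)
      fix m
      have "integral {0..1} (\<lambda>x. cmod (u (x + of_int m))) \<le> integral {0..1::real} (\<lambda>x. B m)"
        by (intro integral_le bound integrable_continuous_interval continuous_intros
            continuous_on_compose2[OF cont]) auto
      then show "integral {0..1} (\<lambda>x. cmod (u (x + of_int m))) \<le> B m" by simp
    qed
    also have "\<dots> \<le> infsum B UNIV"
      using B B0 by (intro finite_sum_le_infsum) auto
    finally show ?thesis .
  qed
  have "incseq (\<lambda>N. integral\<^sup>L lborel (F N))"
    by (intro incseq_SucI integral_mono F_int F_mono) simp
  then obtain l where l: "(\<lambda>N. integral\<^sup>L lborel (F N)) \<longlonglongrightarrow> l"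
    using incseq_convergent[of _ "infsum B UNIV"] bdd by metis
  have "integrable lborel (\<lambda>x. cmod (u x))"
  proof (rule integrable_monotone_convergence[OF F_int _ _ l])
    show "AE x in lborel. mono (\<lambda>n. F n x)" by (auto intro!: monoI F_mono)
    have "(\<lambda>i. F i x) \<longlonglongrightarrow> cmod (u x)" for x
    proof (rule tendsto_eventually, unfold eventually_sequentially, intro exI allI impI)
      fix n assume "n \<ge> nat \<lceil>\<bar>x\<bar>\<rceil>"
      then have "\<bar>x\<bar> \<le> real n" by linarith
      then show "F n x = cmod (u x)" by (auto simp: F_def indicator_def)
    qed
    then show "AE x in lborel. (\<lambda>i. F i x) \<longlonglongrightarrow> cmod (u x)" by simp
  qed measurable
  then show ?thesis by (subst (asm) integrable_norm_iff) auto
qed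

text \<open>The cell sums are the integrals over \<open>[-N, N]\<close>, and the truncations of
  \<open>u\<close> are dominated by its own norm.\<close>

lemma sum_cells_tendsto_lebesgue_integral:
  fixes u :: "real \<Rightarrow> complex"
  assumes cont: "continuous_on UNIV u" and int: "integrable lborel u"
  shows "(\<lambda>N. \<Sum>m\<in>{- int N..<int N}. integral {0..1} (\<lambda>x. u (x + of_int m)))
    \<longlonglongrightarrow> (LINT x|lborel. u x)"
proof -
  define F where "F N x = indicator {- real N..real N} x *\<^sub>R u x" for N x
  have set_int: "set_integrable lborel {- real N..real N} u" for N
    using cont continuous_on_subset by (intro borel_integrable_atLeastAtMost') blast
  have "integral\<^sup>L lborel (F N)
      = (\<Sum>m\<in>{- int N..<int N}. integral {0..1} (\<lambda>x. u (x + of_int m)))" for N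
    using set_borel_integral_eq_integral(2)[OF set_int]
    by (simp add: set_lebesgue_integral_def F_def[abs_def] integral_symmetric_interval_split[OF cont])
  moreover have "(\<lambda>N. integral\<^sup>L lborel (F N)) \<longlonglongrightarrow> (LINT x|lborel. u x)"
  proof (rule integral_dominated_convergence[where w = "\<lambda>x. cmod (u x)"])
    have "(\<lambda>i. F i x) \<longlonglongrightarrow> u x" for x
    proof (rule tendsto_eventually, unfold eventually_sequentially, intro exI allI impI)
      fix n assume "n \<ge> nat \<lceil>\<bar>x\<bar>\<rceil>"
      then have "\<bar>x\<bar> \<le> real n" by linarith
      then show "F n x = u x" by (auto simp: F_def indicator_def)
    qed
    then show "AE x in lborel. (\<lambda>i. F i x) \<longlonglongrightarrow> u x" by simp
    show "F N \<in> borel_measurable lborel" for N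
      using int unfolding F_def[abs_def] by measurable
    show "AE x in lborel. norm (F N x) \<le> cmod (u x)" for N
      by (auto simp: F_def indicator_def)
  qed (use int in auto)
  ultimately show ?thesis by simp
qed

lemma integral_cis_unit_interval:
  "integral {0..1} (\<lambda>x. cis (2 * pi * of_int n * x)) = (if n = 0 then 1 else 0)"
proof (cases "n = 0")
  case False
  define a where "a = 2 * pi * of_int n"
  have a: "a \<noteq> 0" using False by (simp add: a_def)
  have "((\<lambda>x. cis (a * x)) has_integral cis (a * 1) / (\<i> * a) - cis (a * 0) / (\<i> * a)) {0..1}"
    by (rule fundamental_theorem_of_calculus)
      (auto simp: a mult_ac cis_conv_exp has_real_derivative_iff_has_vector_derivative[symmetric]
        intro!: derivative_eq_intros has_vector_derivative_real_field)
  moreover have "cis a = 1"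
    unfolding a_def by (rule cis_multiple_2pi) simp
  ultimately show ?thesis using False by (simp add: a_def integral_unique)
qed simp

text \<open>
  The periodization of \<open>u\<close> and the Fourier series with coefficients \<open>c\<close> are continuous
  and have the same Fourier coefficients, so they agree at the origin. Taking the absolute
  summability of \<open>c\<close> as a hypothesis avoids any use of Fourier inversion.
\<close>

theorem poisson_summation:
  fixes u :: "real \<Rightarrow> complex"
  defines "c \<equiv> \<lambda>k::int. LINT x|lborel. u x * cis (- (2 * pi * of_int k * x))"
  assumes cont: "continuous_on UNIV u"
    and bound: "\<And>k x. x \<in> {0..1} \<Longrightarrow> cmod (u (x + of_int k)) \<le> B k"
    and B: "B summable_on (UNIV :: int set)"
    and c: "(\<lambda>k. cmod (c k)) summable_on UNIV"
  shows "(\<Sum>\<^sub>\<infinity>m::int. u (of_int m)) = (\<Sum>\<^sub>\<infinity>k. c k)"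
proof -
  define G where "G x = (\<Sum>\<^sub>\<infinity>m::int. u (x + of_int m))" for x
  define S where "S x = (\<Sum>\<^sub>\<infinity>k::int. c k * cis (2 * pi * of_int k * x))" for x
  have G_per: "G (x + 1) = G x" for x
  proof -
    have "(\<Sum>\<^sub>\<infinity>m::int. u (x + of_int (m + 1))) = G x"
      unfolding G_def by (rule infsum_reindex_bij_betw[of "\<lambda>m. m + 1"])
        (auto intro!: bij_betwI[of _ _ _ "\<lambda>m. m - 1"])
    then show ?thesis by (simp add: G_def add_ac)
  qed
  have e_per: "cis (2 * pi * of_int k * (x + 1)) = cis (2 * pi * of_int k * x)" for k :: int and x
    by (simp add: distrib_left cis_mult[symmetric])
  have shift: "cis (2 * pi * of_int k * (x + of_int m)) = cis (2 * pi * of_int k * x)"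
    for k m :: int and x
    using periodic_shift_int[of "\<lambda>x. cis (2 * pi * of_int k * x)", OF e_per] .
  have cu: "continuous_on A (\<lambda>x. u (x + of_int m))" for A and m :: int
    by (intro continuous_on_compose2[OF cont] continuous_intros) auto
  have G_cont: "continuous_on {0..1} G"
    unfolding G_def by (rule integral_infsum_unit_interval(1)[OF cu bound B])
  have S_bound: "cmod (c k * cis t) \<le> cmod (c k)" for k t
    by (simp add: norm_mult)
  have S_cont: "continuous_on {0..1} S"
    unfolding S_def
    by (rule integral_infsum_unit_interval(1)[OF _ S_bound c]) (intro continuous_intros)
  \<comment> \<open>Unfolding: the character is 1-periodic, so \<open>G\<close> times the character
    is the periodization of \<open>w\<close>, whose integral over one period is the integral of
    \<open>w\<close> over the line. The index is \<open>- j\<close> because \<open>c\<close> carries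
    the opposite sign in its exponent.\<close>
  have G_coeff: "integral {0..1} (\<lambda>x. G x * cis (2 * pi * of_int j * x)) = c (- j)" for j
  proof -
    define w where "w x = u x * cis (2 * pi * of_int j * x)" for x
    have w_cont: "continuous_on UNIV w"
      unfolding w_def by (intro continuous_intros cont)
    have w_shift: "w (x + of_int m) = u (x + of_int m) * cis (2 * pi * of_int j * x)"
      for x and m :: int by (simp add: w_def shift)
    have w_bound: "cmod (w (x + of_int m)) \<le> B m" if "x \<in> {0..1}" for x m
      using bound[OF that] by (simp add: w_shift norm_mult)
    have "((\<lambda>m. integral {0..1} (\<lambda>x. w (x + of_int m)))
        has_sum integral {0..1} (\<lambda>x. \<Sum>\<^sub>\<infinity>m. w (x + of_int m))) UNIV"
      by (rule integral_infsum_unit_interval(2)[OF _ w_bound B])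
        (auto intro!: continuous_on_compose2[OF w_cont] continuous_intros)
    also have "(\<lambda>x. \<Sum>\<^sub>\<infinity>m. w (x + of_int m)) = (\<lambda>x. G x * cis (2 * pi * of_int j * x))"
      by (simp add: w_shift G_def infsum_cmult_left')
    finally have "(\<lambda>N. \<Sum>m\<in>{- int N..<int N}. integral {0..1} (\<lambda>x. w (x + of_int m)))
        \<longlonglongrightarrow> integral {0..1} (\<lambda>x. G x * cis (2 * pi * of_int j * x))"
      unfolding has_sum_def by (rule filterlim_compose[OF _ filterlim_symmetric_int_intervals])
    moreover have "(\<lambda>N. \<Sum>m\<in>{- int N..<int N}. integral {0..1} (\<lambda>x. w (x + of_int m)))
        \<longlonglongrightarrow> (LINT x|lborel. w x)"
      by (intro sum_cells_tendsto_lebesgue_integral w_cont integrable_of_cell_bound[OF _ w_bound B])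
    \<comment> \<open>Both values are limits of the same symmetric sums of cell integrals.\<close>
    ultimately have "integral {0..1} (\<lambda>x. G x * cis (2 * pi * of_int j * x)) = (LINT x|lborel. w x)"
      by (rule LIMSEQ_unique)
    then show ?thesis by (simp add: w_def c_def)
  qed
  \<comment> \<open>Integrating termwise, orthogonality of characters leaves only the term with
    \<open>k + j = 0\<close>.\<close>
  have S_coeff: "integral {0..1} (\<lambda>x. S x * cis (2 * pi * of_int j * x)) = c (- j)" for j
  proof -
    have e: "c k * cis (2 * pi * of_int k * x) * cis (2 * pi * of_int j * x)
        = c k * cis (2 * pi * of_int (k + j) * x)" for k x
      by (simp add: cis_mult distrib_left distrib_right)
    have "((\<lambda>k. integral {0..1} (\<lambda>x. c k * cis (2 * pi * of_int (k + j) * x)))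
        has_sum integral {0..1} (\<lambda>x. \<Sum>\<^sub>\<infinity>k. c k * cis (2 * pi * of_int (k + j) * x))) UNIV"
      by (rule integral_infsum_unit_interval(2)[OF _ S_bound c]) (intro continuous_intros)
    also have "(\<lambda>x. \<Sum>\<^sub>\<infinity>k. c k * cis (2 * pi * of_int (k + j) * x))
        = (\<lambda>x. S x * cis (2 * pi * of_int j * x))"
      by (simp only: S_def infsum_cmult_left'[symmetric] e)
    also have "(\<lambda>k. integral {0..1} (\<lambda>x. c k * cis (2 * pi * of_int (k + j) * x)))
        = (\<lambda>k. if k = - j then c (- j) else 0)"
      by (simp only: integral_mult_right integral_cis_unit_interval) (auto simp: fun_eq_iff)
    finally have "((\<lambda>k. if k = - j then c (- j) else 0)
        has_sum integral {0..1} (\<lambda>x. S x * cis (2 * pi * of_int j * x))) UNIV" .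
    moreover have "((\<lambda>k. if k = - j then c (- j) else 0) has_sum c (- j)) UNIV"
      by (rule has_sum_finite_neutralI[of "{- j}"]) auto
    ultimately show ?thesis using has_sum_unique by blast
  qed
  have "G 0 - S 0 = 0"
  proof (rule zero_of_fourier_coefficients_zero[where h = "\<lambda>x. G x - S x" and x = 0])
    show "continuous_on {0..1} (\<lambda>x. G x - S x)" by (intro continuous_intros G_cont S_cont)
    show "G (x + 1) - S (x + 1) = G x - S x" for x by (simp only: G_per S_def e_per)
    show "integral {0..1} (\<lambda>x. (G x - S x) * cis (2 * pi * of_int k * x)) = 0" for k :: int
      by (simp add: left_diff_distrib integral_diff integrable_continuous_interval
          continuous_intros G_cont S_cont G_coeff S_coeff)
  qed
  then show ?thesis by (simp add: G_def S_def)
qed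

section \<open>Sampling in the Wiener amalgam space\<close>

text \<open>The \<open>k\<close>-th term of the amalgam norm, named for use as a summable
  majorant.\<close>

definition cell_sup :: "(real \<Rightarrow> complex) \<Rightarrow> int \<Rightarrow> real" where
  "cell_sup g k = (SUP x\<in>{0..1}. cmod (g (x + of_int k)))"

lemma wiener_amalgamD:
  assumes "g \<in> wiener_amalgam"
  shows "continuous_on UNIV g" "cell_sup g summable_on UNIV"
  using assms by (auto simp: wiener_amalgam_def cell_sup_def[abs_def])

lemma norm_le_cell_sup:
  assumes "continuous_on UNIV g" "x \<in> {0..1}"
  shows "cmod (g (x + of_int k)) \<le> cell_sup g k"
  unfolding cell_sup_def
proof (rule cSUP_upper[OF assms(2)])
  have "compact ((\<lambda>x. cmod (g (x + of_int k))) ` {0..1})"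
    by (intro compact_continuous_image continuous_intros continuous_on_compose2[OF assms(1)]) auto
  then show "bdd_above ((\<lambda>x. cmod (g (x + of_int k))) ` {0..1})"
    by (intro bounded_imp_bdd_above compact_imp_bounded)
qed

lemma cell_sup_nonneg: "continuous_on UNIV g \<Longrightarrow> 0 \<le> cell_sup g k"
  using order_trans[OF norm_ge_zero norm_le_cell_sup[of g 0 k]] by simp

text \<open>A progression of integer step at least 1 meets each unit cell \<open>[k, k + 1)\<close>
  at most once, so its sum is dominated by the amalgam norm. The bound is uniform in
  \<open>x\<close>, which later makes the supremum in \<open>decay_rate\<close> finite.\<close>

lemma progression_summable:
  assumes g: "g \<in> wiener_amalgam" and R: "R > 0"
  shows "(\<lambda>k::int. cmod (g (x + of_int k * real R))) summable_on UNIV"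
    and "(\<Sum>\<^sub>\<infinity>k::int. cmod (g (x + of_int k * real R))) \<le> (\<Sum>\<^sub>\<infinity>k. cell_sup g k)"
proof -
  note cont = wiener_amalgamD(1)[OF g] and sum = wiener_amalgamD(2)[OF g]
  \<comment> \<open>The index of the cell containing the \<open>k\<close>-th point of the
    progression.\<close>
  define \<iota> where "\<iota> k = \<lfloor>x\<rfloor> + k * int R" for k
  have inj: "inj \<iota>" using R by (auto simp: inj_def \<iota>_def)
  have le: "cmod (g (x + of_int k * real R)) \<le> (cell_sup g \<circ> \<iota>) k" for k
  proof -
    have "x + of_int k * real R = frac x + of_int (\<iota> k)" by (simp add: \<iota>_def frac_def)
    moreover have "frac x \<in> {0..1}" using frac_lt_1[of x] by simp
    ultimately show ?thesis using norm_le_cell_sup[OF cont] by (simp del: of_int_add)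
  qed
  have sub: "cell_sup g summable_on range \<iota>"
    using summable_on_subset_banach[OF sum] by blast
  then have c: "(cell_sup g \<circ> \<iota>) summable_on UNIV"
    using summable_on_reindex[OF inj] by blast
  show s: "(\<lambda>k::int. cmod (g (x + of_int k * real R))) summable_on UNIV"
    by (rule summable_on_comparison_test[OF c le]) auto
  have "(\<Sum>\<^sub>\<infinity>k::int. cmod (g (x + of_int k * real R))) \<le> infsum (cell_sup g \<circ> \<iota>) UNIV"
    by (rule infsum_mono[OF s c le])
  also have "\<dots> = infsum (cell_sup g) (range \<iota>)"
    by (rule infsum_reindex[OF inj, symmetric])
  also have "\<dots> \<le> infsum (cell_sup g) UNIV"
    using sub sum by (intro infsum_mono2) (auto simp: cell_sup_nonneg cont)
  finally show "(\<Sum>\<^sub>\<infinity>k::int. cmod (g (x + of_int k * real R))) \<le> (\<Sum>\<^sub>\<infinity>k. cell_sup g k)" .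
qed

text \<open>A real supremum dominates its members only if they are bounded above; the amalgam norm
  supplies the bound.\<close>

lemma infsum_le_decay_rate:
  assumes g: "g \<in> wiener_amalgam" and R: "R > 0" and x: "\<bar>x\<bar> \<le> real R / 2"
  shows "(\<Sum>\<^sub>\<infinity>k\<in>UNIV - {0::int}. cmod (g (x + of_int k * real R))) \<le> decay_rate g R"
  unfolding decay_rate_def
proof (rule cSUP_upper)
  have "(\<Sum>\<^sub>\<infinity>k\<in>UNIV - {0::int}. cmod (g (y + of_int k * real R))) \<le> (\<Sum>\<^sub>\<infinity>k. cell_sup g k)" for y
  proof -
    note s = progression_summable[OF g R, of y]
    have "(\<Sum>\<^sub>\<infinity>k\<in>UNIV - {0::int}. cmod (g (y + of_int k * real R)))
        \<le> (\<Sum>\<^sub>\<infinity>k::int. cmod (g (y + of_int k * real R)))"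
      by (intro infsum_mono2 s(1) summable_on_subset_banach[OF s(1)]) auto
    with s(2) show ?thesis by simp
  qed
  then show "bdd_above ((\<lambda>x. \<Sum>\<^sub>\<infinity>k\<in>UNIV - {0::int}. cmod (g (x + of_int k * real R)))
      ` {x. \<bar>x\<bar> \<le> real R / 2})" by (intro bdd_aboveI2)
qed (use x in simp)

section \<open>Residues and regrouping of sums over the integers\<close>

lemma index_range_even:
  assumes "even N"
  shows "index_range N = {- (int N div 2)<..int N div 2}"
  using assms unfolding index_range_def by (elim evenE) auto

lemma card_index_range: "even N \<Longrightarrow> card (index_range N) = N"
  by (auto simp: index_range_even elim!: evenE)

lemma finite_index_range: "even N \<Longrightarrow> finite (index_range N)"
  by (simp add: index_range_even)

text \<open>For even \<open>N\<close> the index range is a complete residue system modulo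
  \<open>N\<close>. Every integer is thus uniquely \<open>j + m * N\<close>, and it lies outside the
  range exactly when \<open>m\<close> is nonzero.\<close>

lemma index_range_residues:
  assumes N: "even N" "N > 0"
  shows "bij_betw (\<lambda>(j, m). j + m * int N) (index_range N \<times> (UNIV - {0})) (- index_range N)"
proof -
  obtain M where M: "N = 2 * M" using N by (elim evenE)
  have I: "index_range N = {- int M<..int M}" using index_range_even[OF N(1)] M by simp
  \<comment> \<open>Two elements of the range differ by less than \<open>N\<close>, so congruent
    ones coincide.\<close>
  have zero: "q = 0" if "\<bar>q * int N\<bar> < int N" for q
  proof (rule ccontr)
    assume "q \<noteq> 0"
    then have "1 * int N \<le> \<bar>q\<bar> * int N" by (intro mult_right_mono) auto
    with that show False by (simp add: abs_mult)
  qed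
  have uniq: "m = m'" if "j \<in> index_range N" "j' \<in> index_range N" "j + m * int N = j' + m' * int N"
    for j j' m m'
  proof -
    have "(m - m') * int N = j' - j" using that by (simp add: algebra_simps)
    moreover have "\<bar>j' - j\<bar> < int N" using that(1,2) unfolding I by (auto simp: M)
    ultimately have "m - m' = 0" by (intro zero) simp
    then show ?thesis by simp
  qed
  show ?thesis
  proof (intro bij_betw_imageI inj_onI equalityI subsetI)
    fix n assume n: "n \<in> - index_range N"
    \<comment> \<open>Adding \<open>M - 1\<close> moves the range \<open>{-M<..M}\<close> onto
      \<open>{0..<N}\<close>, where \<open>mod\<close> picks the representative; the shift is then
      undone.\<close>
    define j where "j = (n + int M - 1) mod int N - int M + 1"
    define m where "m = (n + int M - 1) div int N"
    have jm: "j + m * int N = n"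
      unfolding j_def m_def using div_mult_mod_eq[of "n + int M - 1" "int N"] by linarith
    have "0 \<le> (n + int M - 1) mod int N" "(n + int M - 1) mod int N < int N"
      using N by simp_all
    then have "j \<in> index_range N"
      unfolding I j_def greaterThanAtMost_iff using M by linarith
    moreover from this have "m \<noteq> 0" using n jm by auto
    ultimately show "n \<in> (\<lambda>(j, m). j + m * int N) ` (index_range N \<times> (UNIV - {0}))"
      using jm by (intro image_eqI[of _ _ "(j, m)"]) auto
  next
    fix n assume "n \<in> (\<lambda>(j, m). j + m * int N) ` (index_range N \<times> (UNIV - {0}))"
    then obtain j m where *: "j \<in> index_range N" "m \<noteq> 0" "n = j + m * int N" by auto
    have "n \<notin> index_range N"
    proof
      assume "n \<in> index_range N"
      from uniq[OF *(1) this, of m 0] have "m = 0" by (simp add: *(3))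
      with *(2) show False ..
    qed
    then show "n \<in> - index_range N" by simp
  next
    fix a b assume "a \<in> index_range N \<times> (UNIV - {0})" "b \<in> index_range N \<times> (UNIV - {0})"
      and eq: "(case a of (j, m) \<Rightarrow> j + m * int N) = (case b of (j, m) \<Rightarrow> j + m * int N)"
    then have "snd a = snd b"
      using uniq[of "fst a" "fst b" "snd a" "snd b"] by (simp add: mem_Times_iff case_prod_unfold)
    with eq show "a = b" by (simp add: case_prod_unfold prod_eq_iff)
  qed
qed

text \<open>Division with remainder shows that each value \<open>A q\<close> occurs exactly
  \<open>P\<close> times, once per remainder.\<close>

lemma summable_on_div:
  fixes A :: "int \<Rightarrow> real"
  assumes A: "A summable_on UNIV" and A0: "\<And>k. 0 \<le> A k" and P: "P > 0"
  shows "(\<lambda>m. A (m div P)) summable_on UNIV"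
proof -
  have "(\<lambda>(q, r). A q) summable_on (UNIV \<times> {0..<P})"
  proof (rule summable_on_SigmaI)
    show "((\<lambda>r. case (q, r) of (q, r) \<Rightarrow> A q) has_sum of_int P * A q) {0..<P}" for q
      using has_sum_finite[of "{0..<P}" "\<lambda>_. A q"] P by simp
    show "(\<lambda>q. of_int P * A q) summable_on UNIV" by (intro summable_on_cmult_right A)
  qed (use A0 in auto)
  also have "?this \<longleftrightarrow> (\<lambda>m. (\<lambda>(q, r). A q) (m div P, m mod P)) summable_on UNIV"
  proof (rule summable_on_reindex_bij_betw[symmetric])
    show "bij_betw (\<lambda>m. (m div P, m mod P)) UNIV (UNIV \<times> {0..<P})"
    proof (rule bij_betwI[of _ _ _ "\<lambda>(q, r). q * P + r"])
      show "(\<lambda>m. (m div P, m mod P)) \<in> UNIV \<rightarrow> UNIV \<times> {0..<P}" using P by auto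
    qed (use P in auto)
  qed
  finally show ?thesis by simp
qed

section \<open>Sampled Poisson summation and the error estimate\<close>

lemma fourier_altdef: "fourier f v = (LINT x|lborel. f x * cis (- (2 * pi * x * v)))"
  unfolding fourier_def cis_conv_exp by (simp add: mult_ac)

text \<open>The dilated, modulated function \<open>u\<close> has the samples as its values at the
  integers. Amalgam membership of \<open>f\<close> bounds \<open>u\<close> on unit cells; that of
  \<open>fourier f\<close> makes the Fourier coefficients of the periodization of \<open>u\<close>
  absolutely summable.\<close>

theorem poisson_summation_sampled:
  assumes f: "f \<in> wiener_amalgam" and fh: "fourier f \<in> wiener_amalgam" and P: "P > 0"
  shows "(\<Sum>\<^sub>\<infinity>n::int. f (of_int n / real P) * cis (- (2 * pi * of_int n * v / real P)))
    = of_nat P * (\<Sum>\<^sub>\<infinity>k::int. fourier f (v + of_int k * real P))"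
    and "(\<lambda>n::int. cmod (f (of_int n / real P))) summable_on UNIV"
proof -
  note cont = wiener_amalgamD(1)[OF f]
  define u where "u x = f (x / real P) * cis (- (2 * pi * x * v / real P))" for x
  \<comment> \<open>Scaling by \<open>1 / P\<close> carries the \<open>m\<close>-th unit cell into
    the unit cell of index \<open>m div P\<close>.\<close>
  define B where "B m = cell_sup f (m div int P)" for m
  have norm_u: "cmod (u x) = cmod (f (x / real P))" for x by (simp add: u_def norm_mult)
  have u_cont: "continuous_on UNIV u"
    unfolding u_def using P by (intro continuous_intros continuous_on_compose2[OF cont]) auto
  have bound: "cmod (u (x + of_int m)) \<le> B m" if x: "x \<in> {0..1}" for x m
  proof -
    define q r where "q = m div int P" and "r = m mod int P"
    have m: "m = q * int P + r" by (simp add: q_def r_def)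
    have r: "0 \<le> r" "r + 1 \<le> int P" using P by (simp_all add: r_def add1_zle_eq)
    then have r': "0 \<le> real_of_int r" "real_of_int r + 1 \<le> real P" by linarith+
    have "(x + of_int m) / real P = (x + of_int r) / real P + of_int q"
      using P by (simp add: m field_simps)
    moreover have "(x + of_int r) / real P \<in> {0..1}"
      using x r' P by (simp add: field_simps)
    ultimately show ?thesis
      using norm_le_cell_sup[OF cont] by (simp add: norm_u B_def q_def)
  qed
  have B: "B summable_on UNIV"
    unfolding B_def using P
    by (intro summable_on_div wiener_amalgamD(2)[OF f] cell_sup_nonneg cont) auto
  \<comment> \<open>Substituting \<open>x / P\<close> for \<open>x\<close> in the Fourier integral
    produces the Jacobian \<open>1 / P\<close>, and the frequency shift \<open>k * P\<close> becomes
    the integer frequency \<open>k\<close>.\<close>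
  have coeff: "(LINT x|lborel. u x * cis (- (2 * pi * of_int k * x)))
      = of_nat P * fourier f (v + of_int k * real P)" for k :: int
  proof -
    have "fourier f (v + of_int k * real P)
        = \<bar>1 / real P\<bar> *\<^sub>R (LINT x|lborel. f (0 + 1 / real P * x)
            * cis (- (2 * pi * (0 + 1 / real P * x) * (v + of_int k * real P))))"
      unfolding fourier_altdef using P by (intro lborel_integral_real_affine) simp
    also have "(\<lambda>x. f (0 + 1 / real P * x)
          * cis (- (2 * pi * (0 + 1 / real P * x) * (v + of_int k * real P))))
        = (\<lambda>x. u x * cis (- (2 * pi * of_int k * x)))"
    proof
      fix x
      have "- (2 * pi * (0 + 1 / real P * x) * (v + of_int k * real P))
          = - (2 * pi * x * v / real P) + - (2 * pi * of_int k * x)"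
        using P by (simp add: field_simps)
      then show "f (0 + 1 / real P * x)
          * cis (- (2 * pi * (0 + 1 / real P * x) * (v + of_int k * real P)))
          = u x * cis (- (2 * pi * of_int k * x))"
        by (simp only: cis_mult[symmetric] u_def) simp
    qed
    finally show ?thesis using P by (simp add: scaleR_conv_of_real)
  qed
  have "(\<Sum>\<^sub>\<infinity>n::int. u (of_int n)) = (\<Sum>\<^sub>\<infinity>k::int. of_nat P * fourier f (v + of_int k * real P))"
    unfolding coeff[symmetric]
  proof (rule poisson_summation[OF u_cont bound B])
    show "(\<lambda>k. cmod (LINT x|lborel. u x * cis (- (2 * pi * of_int k * x)))) summable_on UNIV"
      unfolding coeff norm_mult by (intro summable_on_cmult_right progression_summable(1) fh P)
  qed
  then show "(\<Sum>\<^sub>\<infinity>n::int. f (of_int n / real P) * cis (- (2 * pi * of_int n * v / real P)))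
    = of_nat P * (\<Sum>\<^sub>\<infinity>k::int. fourier f (v + of_int k * real P))"
    by (simp add: u_def infsum_cmult_right')
  have "(\<lambda>n. cmod (u (of_int n))) summable_on UNIV"
    by (rule Infinite_Sum.abs_summable_on_comparison_test'[OF B]) (use bound[of 0] in simp)
  then show "(\<lambda>n::int. cmod (f (of_int n / real P))) summable_on UNIV"
    by (simp add: norm_u)
qed

text \<open>For \<open>n = j + m * L * P\<close> the sample point is \<open>j / P + m * L\<close>.
  Each of the \<open>L * P\<close> residue classes thus gives a progression of step \<open>L\<close>
  through \<open>j / P\<close>, a point of modulus at most \<open>L / 2\<close>, with
  \<open>m = 0\<close> left out: a sum controlled by \<open>decay_rate f L\<close>.\<close>

lemma sampled_tail_le:
  assumes f: "f \<in> wiener_amalgam" and L: "L > 0" and P: "P > 0" and even: "even (L * P)"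
    and sum: "(\<lambda>n::int. cmod (f (of_int n / real P))) summable_on UNIV"
  shows "(\<Sum>\<^sub>\<infinity>n\<in>- index_range (L * P). cmod (f (of_int n / real P)))
    \<le> real (L * P) * decay_rate f L"
proof -
  let ?I = "index_range (L * P)"
  have LP: "L * P > 0" using L P by simp
  have point: "of_int (j + m * int (L * P)) / real P = of_int j / real P + of_int m * real L" for j m
    using P by (simp add: field_simps)
  note bij = index_range_residues[OF even LP]
  have *: "(\<lambda>n. cmod (f (of_int n / real P))) summable_on (- ?I)"
    by (rule summable_on_subset_banach[OF sum]) simp
  then have s: "(\<lambda>(j, m). cmod (f (of_int j / real P + of_int m * real L)))
      summable_on (?I \<times> (UNIV - {0}))"
    using summable_on_reindex_bij_betw[OF bij, THEN iffD2, OF *]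
    by (simp only: point case_prod_unfold)
  have "(\<Sum>\<^sub>\<infinity>n\<in>- ?I. cmod (f (of_int n / real P)))
      = (\<Sum>\<^sub>\<infinity>(j, m)\<in>?I \<times> (UNIV - {0}). cmod (f (of_int j / real P + of_int m * real L)))"
    using infsum_reindex_bij_betw[OF bij, of "\<lambda>n. cmod (f (of_int n / real P))"]
    by (simp only: point case_prod_unfold)
  also have "\<dots> = (\<Sum>\<^sub>\<infinity>j\<in>?I. \<Sum>\<^sub>\<infinity>m\<in>UNIV - {0}. cmod (f (of_int j / real P + of_int m * real L)))"
    using infsum_Sigma'_banach[OF s] by simp
  also have "\<dots> = (\<Sum>j\<in>?I. \<Sum>\<^sub>\<infinity>m\<in>UNIV - {0}. cmod (f (of_int j / real P + of_int m * real L)))"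
    by (rule infsum_finite[OF finite_index_range[OF even]])
  also have "\<dots> \<le> (\<Sum>j\<in>?I. decay_rate f L)"
  proof (intro sum_mono infsum_le_decay_rate f L)
    fix j assume "j \<in> ?I"
    then show "\<bar>of_int j / real P\<bar> \<le> real L / 2"
      using P by (auto simp: index_range_def field_simps abs_le_iff)
  qed
  finally show ?thesis by (simp add: card_index_range[OF even])
qed

lemma sampling_error_le:
  assumes f: "f \<in> wiener_amalgam" and fh: "fourier f \<in> wiener_amalgam"
    and L: "L > 0" and P: "P > 0" and even: "even (L * P)" and v: "\<bar>v\<bar> \<le> real P / 2"
  shows "cmod (fourier f v - sampling_poly f P L v)
    \<le> decay_rate (fourier f) P + real L * decay_rate f L"
proof -
  let ?I = "index_range (L * P)"
  define u where "u n = f (of_int n / real P) * cis (- (2 * pi * of_int n * v / real P))" for n :: int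
  define g where "g k = fourier f (v + of_int k * real P)" for k :: int
  note poisson = poisson_summation_sampled[OF f fh P]
  have norm_u: "cmod (u n) = cmod (f (of_int n / real P))" for n by (simp add: u_def norm_mult)
  have ua: "(\<lambda>n. cmod (u n)) summable_on A" for A
    using summable_on_subset_banach[OF poisson(2)] by (simp add: norm_u)
  have ga: "(\<lambda>k. cmod (g k)) summable_on A" for A
    unfolding g_def by (rule summable_on_subset_banach[OF progression_summable(1)[OF fh P]]) simp
  have u_split: "infsum u UNIV = sum u ?I + infsum u (- ?I)"
    using infsum_Un_disjoint[of u ?I "- ?I"] abs_summable_summable[OF ua] finite_index_range[OF even]
    by simp
  have g_split: "infsum g UNIV = g 0 + infsum g (UNIV - {0})"
    using infsum_Un_disjoint[of g "{0}" "UNIV - {0}"] abs_summable_summable[OF ga] by simp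
  have samp: "sampling_poly f P L v = sum u ?I / of_nat P"
    unfolding sampling_poly_def u_def cis_conv_exp by (simp add: mult_ac)
  have "infsum u UNIV = of_nat P * infsum g UNIV"
    unfolding u_def[abs_def] g_def[abs_def] by (rule poisson(1))
  \<comment> \<open>Poisson summation divided by \<open>P\<close>: the terms in \<open>?I\<close>
    form the sampling polynomial and \<open>g 0\<close> is \<open>fourier f v\<close>, so the error
    is the truncated tail minus the aliases.\<close>
  then have "fourier f v - sampling_poly f P L v = infsum u (- ?I) / of_nat P - infsum g (UNIV - {0})"
    using P by (simp add: u_split g_split samp g_def field_simps)
  also have "cmod \<dots> \<le> cmod (infsum u (- ?I)) / real P + cmod (infsum g (UNIV - {0}))"
    using norm_triangle_ineq4 by (rule order_trans) (simp add: norm_divide)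
  also have "\<dots> \<le> real (L * P) * decay_rate f L / real P + decay_rate (fourier f) P"
  proof (intro add_mono divide_right_mono)
    show "cmod (infsum u (- ?I)) \<le> real (L * P) * decay_rate f L"
      using norm_infsum_bound[OF ua[of "- ?I"]] sampled_tail_le[OF f L P even poisson(2)]
      by (simp add: norm_u)
    show "cmod (infsum g (UNIV - {0})) \<le> decay_rate (fourier f) P"
      using norm_infsum_bound[OF ga[of "UNIV - {0}"]] infsum_le_decay_rate[OF fh P v]
      by (simp add: g_def[abs_def])
  qed simp
  finally show ?thesis using P by simp
qed

theorem theorem3p5:
  fixes L P :: nat and f :: "real \<Rightarrow> complex"
  assumes "even L" and "L > 0" and "even P" and "P > 0"
    and "f \<in> wiener_amalgam" and "fourier f \<in> wiener_amalgam"
  shows "discrete_max_error f P L \<le> max_error f P L \<and>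
         max_error f P L \<le>
           1 / sqrt (real L) * decay_rate (fourier f) P + sqrt (real L) * decay_rate f L"
proof
  define V where "V = {v. \<bar>v\<bar> \<le> real P / 2}"
  define E where "E v = cmod (fourier f v - sampling_poly f P L v)" for v
  have even: "even (L * P)" using assms by simp
  have "0 \<in> V" by (simp add: V_def)
  have E_le: "E v \<le> decay_rate (fourier f) P + real L * decay_rate f L" if "v \<in> V" for v
    using sampling_error_le[OF assms(5,6,2,4) even, of v] that by (simp add: E_def V_def)
  \<comment> \<open>The pointwise estimate also makes the supremum over \<open>V\<close> a genuine
    upper bound, as the discrete comparison requires.\<close>
  then have bdd: "bdd_above (E ` V)" by (intro bdd_aboveI2)
  \<comment> \<open>Nonemptiness, without which \<open>Max\<close> is unspecified.\<close>
  have "0 \<in> index_range (L * P)" using assms by (simp add: index_range_def)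
  then have "Max ((\<lambda>k. E (of_int k / real L)) ` index_range (L * P)) \<le> (SUP v\<in>V. E v)"
  proof (subst Max_le_iff)
    show "\<forall>a\<in>(\<lambda>k. E (of_int k / real L)) ` index_range (L * P). a \<le> (SUP v\<in>V. E v)"
    proof
      fix a assume "a \<in> (\<lambda>k. E (of_int k / real L)) ` index_range (L * P)"
      then obtain k where k: "k \<in> index_range (L * P)" "a = E (of_int k / real L)" by auto
      \<comment> \<open>From \<bar>k\<bar> \<le> LP/2, dividing by \<open>L\<close> puts the grid
        point into \<open>[-P/2, P/2]\<close>.\<close>
      then have "of_int k / real L \<in> V"
        using assms(2) by (auto simp: V_def index_range_def field_simps abs_le_iff)
      then show "a \<le> (SUP v\<in>V. E v)" unfolding k(2) by (rule cSUP_upper[OF _ bdd])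
    qed
  qed (auto simp: finite_index_range[OF even])
  then show "discrete_max_error f P L \<le> max_error f P L"
    unfolding discrete_max_error_def max_error_def E_def V_def by (intro mult_left_mono) simp_all
  have sqrt_L: "1 / sqrt (real L) * real L = sqrt (real L)" by (simp add: real_div_sqrt)
  have "(SUP v\<in>V. E v) \<le> decay_rate (fourier f) P + real L * decay_rate f L"
    using \<open>0 \<in> V\<close> by (intro cSUP_least E_le) auto
  then have "max_error f P L
      \<le> 1 / sqrt (real L) * (decay_rate (fourier f) P + real L * decay_rate f L)"
    unfolding max_error_def E_def V_def by (intro mult_left_mono) simp_all
  also have "\<dots> = 1 / sqrt (real L) * decay_rate (fourier f) P + sqrt (real L) * decay_rate f L"
    by (simp only: distrib_left mult.assoc[symmetric] sqrt_L)
  finally show "max_error f P L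
      \<le> 1 / sqrt (real L) * decay_rate (fourier f) P + sqrt (real L) * decay_rate f L" .
qed

end
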